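(* For every $n \ge 1$, the fan graph $F_n = K_1 \vee P_n$ satisfies $l(-F_n) = l_{\max}(F_n) = \left\lfloor \frac{n}{2} \right\rfloor$.
   Context: All graphs are finite, simple and undirected. A signed graph $\Sigma=(G,\sigma)$ is a graph $G$ with a signature $\sigma:E(G)\to\{+1,-1\}$. The sign of a cycle is the product of the signs of its edges; $\Sigma$ is balanced if all its cycles are positive. The frustration index $l(\Sigma)$ is the minimum number of edges whose deletion makes $\Sigma$ balanced. $-G$ is $G$ with all edges signed $-1$. $l_{\max}(G)=\max_\sigma l(G,\sigma)$ over all signatures of $G$. $P_n$ is the path on $n$ vertices and $\vee$ denotes the join of vertex-disjoint graphs. *)

theory Defs
  imports Complex_Main "HOL-Library.FuncSet"
begin

type_synonym 'a graph = "'a set \<times> 'a set set"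
type_synonym 'a signature = "'a set \<Rightarrow> int"
type_synonym 'a signed_graph = "'a graph \<times> 'a signature"

definition verts :: "'a graph \<Rightarrow> 'a set" where
  "verts G = fst G"

definition edges :: "'a graph \<Rightarrow> 'a set set" where
  "edges G = snd G"

definition simple_graph :: "'a graph \<Rightarrow> bool" where
  "simple_graph G \<longleftrightarrow>
     finite (verts G) \<and> (\<forall>e\<in>edges G. e \<subseteq> verts G \<and> card e = 2)"

(* The values of a signature outside the edge set are unconstrained; none of the
   notions below depends on them. *)
definition signatures :: "'a graph \<Rightarrow> 'a signature set" where
  "signatures G = edges G \<rightarrow> {1, -1}"

definition delete_edges :: "'a graph \<Rightarrow> 'a set set \<Rightarrow> 'a graph" where
  "delete_edges G D = (verts G, edges G - D)"

(* The list vs stands for the cycle vs!0, vs!1, ..., vs!(k-1), vs!0 with k = length vs;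
   cycle_edge vs i joins vs!i to its cyclic successor. As k >= 3 and vs is distinct,
   the k edges are pairwise different. *)
definition cycle_edge :: "'a list \<Rightarrow> nat \<Rightarrow> 'a set" where
  "cycle_edge vs i = {vs ! i, vs ! (Suc i mod length vs)}"

definition is_cycle :: "'a graph \<Rightarrow> 'a list \<Rightarrow> bool" where
  "is_cycle G vs \<longleftrightarrow>
     3 \<le> length vs \<and> distinct vs \<and> set vs \<subseteq> verts G \<and>
     (\<forall>i<length vs. cycle_edge vs i \<in> edges G)"

definition cycle_sign :: "'a signature \<Rightarrow> 'a list \<Rightarrow> int" where
  "cycle_sign \<sigma> vs = (\<Prod>i<length vs. \<sigma> (cycle_edge vs i))"

definition balanced :: "'a signed_graph \<Rightarrow> bool" where
  "balanced S \<longleftrightarrow> (\<forall>vs. is_cycle (fst S) vs \<longrightarrow> cycle_sign (snd S) vs = 1)"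

definition frustration_index :: "'a signed_graph \<Rightarrow> nat" where
  "frustration_index S =
     Min {card D | D. D \<subseteq> edges (fst S) \<and> balanced (delete_edges (fst S) D, snd S)}"

definition all_negative :: "'a graph \<Rightarrow> 'a signed_graph" where
  "all_negative G = (G, \<lambda>e. -1)"

definition max_frustration :: "'a graph \<Rightarrow> nat" where
  "max_frustration G = Max {frustration_index (G, \<sigma>) | \<sigma>. \<sigma> \<in> signatures G}"

definition graph_join :: "'a graph \<Rightarrow> 'a graph \<Rightarrow> 'a graph" where
  "graph_join G H =
     (verts G \<union> verts H,
      edges G \<union> edges H \<union> {{u, v} | u v. u \<in> verts G \<and> v \<in> verts H})"

definition complete_graph :: "'a set \<Rightarrow> 'a graph" where
  "complete_graph V = (V, {{u, v} | u v. u \<in> V \<and> v \<in> V \<and> u \<noteq> v})"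

definition path_graph :: "nat \<Rightarrow> nat graph" where
  "path_graph n = ({1..n}, {{i, Suc i} | i. 1 \<le> i \<and> i < n})"

(* K_1 is placed on the vertex 0, which is not a vertex of path_graph n. *)
definition fan_graph :: "nat \<Rightarrow> nat graph" where
  "fan_graph n = graph_join (complete_graph {0}) (path_graph n)"

lemma simple_graph_fan: "simple_graph (fan_graph n)"
  by (auto simp: simple_graph_def fan_graph_def graph_join_def complete_graph_def
      path_graph_def verts_def edges_def card_insert_if)

lemma finite_edges:
  assumes "simple_graph G"
  shows "finite (edges G)"
proof (rule finite_subset)
  show "edges G \<subseteq> Pow (verts G)"
    using assms by (auto simp: simple_graph_def)
  show "finite (Pow (verts G))"
    using assms by (simp add: simple_graph_def)
qed

(* The Min in frustration_index and the Max in max_frustration range over finite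
   nonempty sets. *)
lemma frustration_index_set:
  assumes "simple_graph G"
  shows "finite {card D | D. D \<subseteq> edges G \<and> balanced (delete_edges G D, \<sigma>)}" (is "finite ?A")
    and "{card D | D. D \<subseteq> edges G \<and> balanced (delete_edges G D, \<sigma>)} \<noteq> {}"
proof -
  have "?A \<subseteq> card ` Pow (edges G)"
    by auto
  then show "finite ?A"
    by (rule finite_subset) (simp add: finite_edges[OF assms])
  have "\<not> is_cycle (delete_edges G (edges G)) vs" for vs :: "'a list"
  proof
    assume "is_cycle (delete_edges G (edges G)) vs"
    then have "3 \<le> length vs" "\<forall>i<length vs. cycle_edge vs i \<in> {}"
      by (auto simp: is_cycle_def delete_edges_def edges_def)
    then show False
      by (auto dest!: spec[of _ 0])
  qed
  then have "balanced (delete_edges G (edges G), \<sigma>)"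
    by (simp add: balanced_def)
  then show "?A \<noteq> {}"
    by auto
qed

lemma max_frustration_set:
  assumes "simple_graph G"
  shows "finite {frustration_index (G, \<sigma>) | \<sigma>. \<sigma> \<in> signatures G}" (is "finite ?A")
    and "{frustration_index (G, \<sigma>) | \<sigma>. \<sigma> \<in> signatures G} \<noteq> {}"
proof -
  have "frustration_index (G, \<sigma>) \<le> card (edges G)" for \<sigma>
  proof -
    have "frustration_index (G, \<sigma>) \<in> {card D | D. D \<subseteq> edges G \<and> balanced (delete_edges G D, \<sigma>)}"
      unfolding frustration_index_def fst_conv snd_conv
      by (rule Min_in) (fact frustration_index_set[OF assms])+
    then show ?thesis
      using card_mono[OF finite_edges[OF assms]] by auto
  qed
  then have "?A \<subseteq> {..card (edges G)}"
    by auto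
  then show "finite ?A"
    by (rule finite_subset) simp
  have "(\<lambda>e. 1) \<in> signatures G"
    by (simp add: signatures_def)
  then show "?A \<noteq> {}"
    by blast
qed

end

(* The fan on n + 1 vertices contains n div 2 edge-disjoint triangles through the hub, all of
   them negative when every edge is; a balancing deletion must hit each. Conversely, for an
   arbitrary signature, switch the path so that all its edges become positive. Switching the
   hub or not decides which of the two sign classes of spokes is deleted to balance the graph,
   and the smaller class has at most n div 2 spokes. *)
theory Submission
  imports Defs
begin

text \<open>The cyclic successor permutes the indices: the last factor wraps round to
  \<open>f 0\<close>, and the others are shifted by one.\<close>

lemma prod_cyclic_shift: "(\<Prod>i<k. f (Suc i mod k)) = (\<Prod>i<k. f i)"
proof (cases k)
  case (Suc m)
  have "(\<Prod>i<m. f (Suc i mod Suc m)) = (\<Prod>i<m. f (Suc i))"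
    by (rule prod.cong) auto
  then have "(\<Prod>i<Suc m. f (Suc i mod Suc m)) = f 0 * (\<Prod>i<m. f (Suc i))"
    by (simp add: mult.commute)
  then show ?thesis
    unfolding Suc prod.lessThan_Suc_shift[of f m] .
qed simp

text \<open>Each vertex of a cycle lies on exactly two of its edges, so the sign of the cycle is a
  product of squares of values of \<theta>. Such a \<theta> is a switching function that turns
  \<sigma> into the all-positive signature.\<close>

lemma balanced_if_switching:
  fixes \<theta> :: "'a \<Rightarrow> int"
  assumes edge: "\<And>u v. {u, v} \<in> edges G \<Longrightarrow> \<sigma> {u, v} = \<theta> u * \<theta> v"
    and sq: "\<And>v. v \<in> verts G \<Longrightarrow> \<theta> v * \<theta> v = 1"
  shows "balanced (G, \<sigma>)"
  unfolding balanced_def fst_conv snd_conv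
proof (intro allI impI)
  fix vs
  assume cyc: "is_cycle G vs"
  let ?k = "length vs"
  have "cycle_sign \<sigma> vs = (\<Prod>i<?k. \<theta> (vs ! i) * \<theta> (vs ! (Suc i mod ?k)))"
    using cyc unfolding cycle_sign_def is_cycle_def cycle_edge_def
    by (intro prod.cong refl edge) auto
  also have "\<dots> = (\<Prod>i<?k. \<theta> (vs ! i) * \<theta> (vs ! i))"
    by (simp add: prod.distrib prod_cyclic_shift[where f = "\<lambda>i. \<theta> (vs ! i)"])
  also have "\<dots> = 1"
    using cyc unfolding is_cycle_def by (intro prod.neutral ballI sq) auto
  finally show "cycle_sign \<sigma> vs = 1" .
qed

lemma verts_delete_edges [simp]: "verts (delete_edges G D) = verts G"
  and edges_delete_edges [simp]: "edges (delete_edges G D) = edges G - D"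
  by (simp_all add: delete_edges_def verts_def edges_def)

lemma verts_fan: "verts (fan_graph n) = {0..n}"
  by (auto simp: fan_graph_def graph_join_def complete_graph_def path_graph_def verts_def)

lemma edges_fan:
  "edges (fan_graph n) = (\<lambda>i. {0, i}) ` {1..n} \<union> (\<lambda>i. {i, Suc i}) ` {1..<n}"
  by (auto simp: fan_graph_def graph_join_def complete_graph_def path_graph_def
      verts_def edges_def)

lemma frustration_index_le:
  assumes "simple_graph G" "D \<subseteq> edges G" "balanced (delete_edges G D, \<sigma>)"
  shows "frustration_index (G, \<sigma>) \<le> card D"
  unfolding frustration_index_def fst_conv snd_conv
  by (rule Min_le[OF frustration_index_set(1)[OF assms(1)]]) (use assms in blast)

lemma frustration_index_ge:
  assumes "simple_graph G"
    and "\<And>D. D \<subseteq> edges G \<Longrightarrow> balanced (delete_edges G D, \<sigma>) \<Longrightarrow> m \<le> card D"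
  shows "m \<le> frustration_index (G, \<sigma>)"
  unfolding frustration_index_def fst_conv snd_conv
  by (rule Min.boundedI) (use assms frustration_index_set[OF assms(1)] in auto)

lemma frustration_all_negative_fan_ge:
  "n div 2 \<le> frustration_index (all_negative (fan_graph n))"
  unfolding all_negative_def
proof (rule frustration_index_ge[OF simple_graph_fan])
  fix D
  assume D: "D \<subseteq> edges (fan_graph n)"
    and bal: "balanced (delete_edges (fan_graph n) D, \<lambda>e. -1)"
  \<comment> \<open>recovers \<open>j\<close> from any edge of the triangle on \<open>0\<close>, \<open>2 * j + 1\<close>, \<open>2 * j + 2\<close>\<close>
  define g where "g e = (Max e - 1) div 2" for e :: "nat set"
  \<comment> \<open>Edge-disjointness of the triangles is expressed by \<open>g\<close> being a
    function: distinct triangles need distinct edges of \<open>D\<close>, so the bound on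
    \<open>card D\<close> follows from surjectivity.\<close>
  have "{..<n div 2} \<subseteq> g ` D"
  proof
    fix j
    assume "j \<in> {..<n div 2}"
    then have j: "2 * j + 2 \<le> n" by auto
    let ?vs = "[0, 2 * j + 1, 2 * j + 2]"
    have "cycle_sign (\<lambda>e. -1) ?vs = -1"
      by (simp add: cycle_sign_def)
    then have not_cycle: "\<not> is_cycle (delete_edges (fan_graph n) D) ?vs"
      using bal unfolding balanced_def by fastforce
    have tri: "cycle_edge ?vs i \<in> {{0, 2 * j + 1}, {2 * j + 1, 2 * j + 2}, {0, 2 * j + 2}}"
      if "i < length ?vs" for i
    proof -
      from that consider "i = 0" | "i = 1" | "i = 2" by fastforce
      then show ?thesis by cases (simp_all add: cycle_edge_def insert_commute)
    qed
    have "{{0, 2 * j + 1}, {2 * j + 1, 2 * j + 2}, {0, 2 * j + 2}} \<subseteq> edges (fan_graph n)"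
      using j unfolding edges_fan by auto
    then have edge: "cycle_edge ?vs i \<in> edges (fan_graph n)" if "i < length ?vs" for i
      using tri[OF that] by (rule subsetD)
    have "set ?vs \<subseteq> verts (fan_graph n)" "distinct ?vs" "3 \<le> length ?vs"
      using j by (auto simp: verts_fan)
    with not_cycle have "\<not> (\<forall>i<length ?vs. cycle_edge ?vs i \<in> edges (fan_graph n) - D)"
      unfolding is_cycle_def verts_delete_edges edges_delete_edges by argo
    with edge obtain i where i: "i < length ?vs" "cycle_edge ?vs i \<in> D"
      unfolding Diff_iff by meson
    \<comment> \<open>The maximum of each edge is \<open>2 * j + 1\<close> or
      \<open>2 * j + 2\<close>; subtracting 1 and halving gives \<open>j\<close> in both
      cases.\<close>
    have "g {0, 2 * j + 1} = j" "g {2 * j + 1, 2 * j + 2} = j" "g {0, 2 * j + 2} = j"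
      by (simp_all add: g_def)
    then have "g (cycle_edge ?vs i) = j"
      using tri[OF i(1)] by (elim insertE emptyE) (simp_all only:)
    with i(2) show "j \<in> g ` D" by (metis imageI)
  qed
  moreover have "finite D"
    using D finite_edges[OF simple_graph_fan] by (rule finite_subset)
  ultimately show "n div 2 \<le> card D"
    using surj_card_le[of D "{..<n div 2}" g] by simp
qed

lemma frustration_fan_le:
  assumes "\<sigma> \<in> signatures (fan_graph n)"
  shows "frustration_index (fan_graph n, \<sigma>) \<le> n div 2"
proof -
  \<comment> \<open>Sign of the path from 1 to \<open>i\<close>, with \<open>p 1 = 1\<close> as an
    empty product; switching by \<open>p\<close> makes every path edge positive.\<close>
  define p where "p i = (\<Prod>j=1..<i. \<sigma> {j, Suc j})" for i :: nat
  \<comment> \<open>Ends of the spokes that stay negative when the path is switched by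
    \<open>p\<close> and the hub by \<open>c\<close>.\<close>
  define I where "I c = {i \<in> {1..n}. \<sigma> {0, i} \<noteq> c * p i}" for c :: int
  have sgn: "\<sigma> e = 1 \<or> \<sigma> e = -1" if "e \<in> edges (fan_graph n)" for e
    using assms that by (auto simp: signatures_def)
  \<comment> \<open>The bound on \<open>i\<close> keeps all factors on edges of the fan, where
    \<sigma> is known to be a sign.\<close>
  have p_sq: "p i * p i = 1" if "i \<le> n" for i
    unfolding p_def prod.distrib[symmetric]
  proof (rule prod.neutral, rule ballI)
    fix j
    assume "j \<in> {1..<i}"
    then have "{j, Suc j} \<in> edges (fan_graph n)"
      using that by (auto simp: edges_fan)
    then show "\<sigma> {j, Suc j} * \<sigma> {j, Suc j} = 1"
      using sgn by fastforce
  qed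
  have p_edge: "\<sigma> {i, Suc i} = p i * p (Suc i)" if "1 \<le> i" "i < n" for i
  proof -
    have "p i * p (Suc i) = (p i * p i) * \<sigma> {i, Suc i}"
      using that by (simp add: p_def mult.assoc)
    then show ?thesis using p_sq[of i] that by simp
  qed
  have le: "frustration_index (fan_graph n, \<sigma>) \<le> card (I c)" if c: "c * c = 1" for c
  proof -
    define D where "D = (\<lambda>i. {0, i}) ` I c"
    define \<theta> where "\<theta> v = (if v = 0 then c else p v)" for v
    have "balanced (delete_edges (fan_graph n) D, \<sigma>)"
    proof (rule balanced_if_switching)
      fix u v
      assume "{u, v} \<in> edges (delete_edges (fan_graph n) D)"
      then have "{u, v} \<in> edges (fan_graph n)" and nD: "{u, v} \<notin> D"
        by auto
      then consider (spoke) i where "i \<in> {1..n}" "{u, v} = {0, i}"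
        | (path) i where "i \<in> {1..<n}" "{u, v} = {i, Suc i}"
        by (auto simp: edges_fan)
      then show "\<sigma> {u, v} = \<theta> u * \<theta> v"
      proof cases
        case spoke
        \<comment> \<open>A spoke that survives the deletion has its end outside \<open>I c\<close>,
          so its sign is \<open>c * p i\<close>.\<close>
        then have "\<sigma> {0, i} = \<theta> 0 * \<theta> i"
          using nD by (auto simp: D_def I_def \<theta>_def)
        then show ?thesis
          using spoke(2) by (auto simp: doubleton_eq_iff mult.commute insert_commute)
      next
        case path
        then have "\<sigma> {i, Suc i} = \<theta> i * \<theta> (Suc i)"
          using p_edge[of i] by (auto simp: \<theta>_def)
        then show ?thesis
          using path(2) by (auto simp: doubleton_eq_iff mult.commute insert_commute)
      qed
    next
      fix v
      assume "v \<in> verts (delete_edges (fan_graph n) D)"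
      then have "v \<le> n"
        by (simp add: verts_fan)
      then show "\<theta> v * \<theta> v = 1"
        using c p_sq by (simp add: \<theta>_def)
    qed
    moreover have "D \<subseteq> edges (fan_graph n)"
      by (auto simp: D_def I_def edges_fan)
    ultimately have "frustration_index (fan_graph n, \<sigma>) \<le> card D"
      by (intro frustration_index_le simple_graph_fan)
    also have "\<dots> \<le> card (I c)"
      unfolding D_def by (rule card_image_le) (simp add: I_def)
    finally show ?thesis .
  qed
  \<comment> \<open>A spoke sign equals \<open>p i\<close> or \<open>- p i\<close>, so it cannot
    disagree with both hub choices. Hence the two deletions together use at most \<open>n\<close>
    spokes, and one of them uses at most \<open>n div 2\<close>.\<close>
  have "I 1 \<inter> I (-1) = {}"
  proof -
    have "\<sigma> {0, i} = p i \<or> \<sigma> {0, i} = - p i" if "i \<in> {1..n}" for i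
    proof -
      have "{0, i} \<in> edges (fan_graph n)" using that by (auto simp: edges_fan)
      moreover have "p i = 1 \<or> p i = -1"
        using p_sq[of i] that by (simp add: zmult_eq_1_iff)
      ultimately show ?thesis using sgn by fastforce
    qed
    then show ?thesis by (auto simp: I_def)
  qed
  then have "card (I 1) + card (I (-1)) = card (I 1 \<union> I (-1))"
    by (intro card_Un_disjoint[symmetric]) (auto simp: I_def)
  also have "\<dots> \<le> card {1..n}"
    by (intro card_mono) (auto simp: I_def)
  finally show ?thesis
    using le[of 1] le[of "-1"] by simp
qed

theorem mainTheorem6:
  fixes n :: nat
  assumes "n \<ge> 1"
  shows "frustration_index (all_negative (fan_graph n)) = max_frustration (fan_graph n)
       \<and> max_frustration (fan_graph n) = n div 2"
proof -
  let ?F = "{frustration_index (fan_graph n, \<sigma>) | \<sigma>. \<sigma> \<in> signatures (fan_graph n)}"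
  have neg: "(\<lambda>e. -1) \<in> signatures (fan_graph n)"
    by (simp add: signatures_def)
  then have eq: "frustration_index (all_negative (fan_graph n)) = n div 2"
    using frustration_fan_le[OF neg] frustration_all_negative_fan_ge[of n]
    by (simp add: all_negative_def)
  \<comment> \<open>The upper bound holds for every signature and is attained by the all-negative
    one.\<close>
  have "Max ?F = n div 2"
  proof (rule Max_eqI)
    show "finite ?F" by (rule max_frustration_set[OF simple_graph_fan])
    show "n div 2 \<in> ?F" using neg eq unfolding all_negative_def by force
  qed (use frustration_fan_le in auto)
  then show ?thesis
    using eq by (simp add: max_frustration_def)
qed

end
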